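(* Let $G$ be a connected simple graph with vertex set $V=\{v_1,\ldots,v_n\}$ and let $\mathbb{R}_+\mathcal{A}$ be its edge cone. Then $$\mathbb{R}_+\mathcal{A}=\left(\bigcap_{A\in\mathcal{F}} H_A^-\right)\cap\left(\bigcap_{i=1}^n H_{e_i}^+\right),$$ where $\mathcal{F}$ is the family of all independent sets of vertices of $G$ and $H_{e_i}^+=\{x\in\mathbb{R}^n\mid x_i\ge 0\}$.
   Context: $e_i$ denotes the $i$-th unit vector of $\mathbb{R}^n$. The edge cone of $G$ is the cone $\mathbb{R}_+\mathcal{A}=\{\sum_k a_k\alpha_k \mid a_k\ge 0\}$ generated by the set $\mathcal{A}$ of all vectors $e_i+e_j$ such that $\{v_i,v_j\}$ is an edge of $G$. A set $A$ of vertices is independent if no two vertices of $A$ are adjacent. For $A\subset V$, $N(A)$ is the set of vertices adjacent to some vertex of $A$. For an independent set $A$, $H_A$ denotes the hyperplane $\{x\in\mathbb{R}^n\mid \sum_{v_i\in A}x_i=\sum_{v_i\in N(A)}x_i\}$ and $H_A^-=\{x\in\mathbb{R}^n\mid \sum_{v_i\in A}x_i\le\sum_{v_i\in N(A)}x_i\}$. *)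

theory Defs
  imports "HOL-Analysis.Analysis"
begin

text \<open>
  The vertex set \<open>{v\<^sub>1, \<dots>, v\<^sub>n}\<close> is the (finite, nonempty) index type \<open>'n\<close> of the
  ambient space \<open>real ^ 'n\<close>, so that the vertex \<open>v\<^sub>i\<close> is identified with the index \<open>i\<close>.
  A graph on these vertices is given by its set of edges.
\<close>

definition simple_graph :: "'n::finite set set \<Rightarrow> bool" where
  "simple_graph E \<longleftrightarrow> (\<forall>e\<in>E. card e = 2)"

definition connected_graph :: "'n::finite set set \<Rightarrow> bool" where
  "connected_graph E \<longleftrightarrow> (\<forall>u v. (u, v) \<in> {(a, b). {a, b} \<in> E}\<^sup>*)"

definition independent_set :: "'n::finite set set \<Rightarrow> 'n set \<Rightarrow> bool" where
  "independent_set E A \<longleftrightarrow> (\<forall>u\<in>A. \<forall>v\<in>A. {u, v} \<notin> E)"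

definition neighbors :: "'n::finite set set \<Rightarrow> 'n set \<Rightarrow> 'n set" where
  "neighbors E A = {v. \<exists>u\<in>A. {u, v} \<in> E}"

definition edge_vectors :: "'n::finite set set \<Rightarrow> (real ^ 'n) set" where
  "edge_vectors E = {axis i 1 + axis j 1 | i j. {i, j} \<in> E}"

text \<open>
  The index type is finite, hence so is \<^term>\<open>edge_vectors E\<close>, and the sum below is a
  genuine finite sum. Without edges the cone is \<open>{0}\<close>.
\<close>

definition edge_cone :: "'n::finite set set \<Rightarrow> (real ^ 'n) set" where
  "edge_cone E = {(\<Sum>\<alpha>\<in>edge_vectors E. a \<alpha> *\<^sub>R \<alpha>) | a. \<forall>\<alpha>\<in>edge_vectors E. 0 \<le> a \<alpha>}"

definition H_minus :: "'n::finite set set \<Rightarrow> 'n set \<Rightarrow> (real ^ 'n) set" where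
  "H_minus E A = {x. (\<Sum>i\<in>A. x $ i) \<le> (\<Sum>i\<in>neighbors E A. x $ i)}"

definition H_unit_plus :: "'n::finite \<Rightarrow> (real ^ 'n) set" where
  "H_unit_plus i = {x. 0 \<le> x $ i}"

end

theory Submission
  imports Defs
begin

text \<open>
  By Farkas' lemma it suffices that every \<open>a\<close> with \<open>a\<^sub>i + a\<^sub>j \<ge> 0\<close> on all edges satisfies
  \<open>a \<bullet> x \<ge> 0\<close> whenever \<open>x\<close> lies in all the half-spaces. For \<open>t \<ge> 0\<close> the level set
  \<open>A\<^sub>t = {i. a\<^sub>i < -t}\<close> is independent and its neighbours lie in \<open>{i. a\<^sub>i > t}\<close>, so the
  \<open>x\<close>-weight of the former is at most that of the latter. Integrating over \<open>t\<close> gives the claim.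
\<close>

text \<open>On \<open>{0..M}\<close> only one of the two indicators can be nonzero, depending on the
  sign of \<open>a\<close>, and its support has length \<open>\<bar>a\<bar>\<close>. The bound
  \<open>M\<close> is free so that all coordinates of a vector can share one interval.\<close>

lemma layer_cake_has_integral:
  fixes a M :: real
  assumes "\<bar>a\<bar> \<le> M"
  shows "((\<lambda>t. of_bool (t < a) - of_bool (t < - a)) has_integral a) {0..M}"
proof -
  have pos: "((\<lambda>t. of_bool (t < b) :: real) has_integral b) {0..M}" if "0 \<le> b" "b \<le> M" for b
  proof -
    have "((\<lambda>t. 1 :: real) has_integral b) {0..b}"
      using has_integral_const_real[of "1 :: real" 0 b] that by simp
    then have "((\<lambda>t. if t \<in> {0..b} then 1 else 0 :: real) has_integral b) {0..M}"
      using that by (subst has_integral_restrict) auto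
    then show ?thesis
      \<comment> \<open>The integrands for \<open>t \<le> b\<close> and \<open>t < b\<close> differ
        only at \<open>t = b\<close>.\<close>
      by (rule has_integral_spike_finite[of "{b}", rotated 2]) auto
  qed
  have zero: "((\<lambda>t. of_bool (t < b) :: real) has_integral 0) {0..M}" if "b \<le> 0" for b
    using that by (intro has_integral_is_0) auto
  show ?thesis
  proof (cases "0 \<le> a")
    case True
    then show ?thesis
      using has_integral_diff[OF pos[of a] zero[of "- a"]] assms by simp
  next
    case False
    then show ?thesis
      using has_integral_diff[OF zero[of a] pos[of "- a"]] assms by simp
  qed
qed

lemma inner_nonneg_if_nonneg_on_edges:
  fixes a x :: "real ^ 'n::finite"
  assumes edges: "\<And>i j. {i, j} \<in> E \<Longrightarrow> 0 \<le> a $ i + a $ j"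
    and nonneg: "\<And>i. 0 \<le> x $ i"
    and indep: "\<And>A. independent_set E A \<Longrightarrow> (\<Sum>i\<in>A. x $ i) \<le> (\<Sum>i\<in>neighbors E A. x $ i)"
  shows "0 \<le> a \<bullet> x"
proof -
  let ?f = "\<lambda>t. \<Sum>i\<in>UNIV. (of_bool (t < a $ i) - of_bool (t < - (a $ i))) * x $ i"
  have "(?f has_integral (\<Sum>i\<in>UNIV. a $ i * x $ i)) {0..norm a}"
    by (intro has_integral_sum has_integral_mult_left layer_cake_has_integral)
      (auto simp: component_le_norm_cart)
  moreover have "0 \<le> ?f t" if "t \<in> {0..norm a}" for t
  proof -
    let ?A = "{i. t < - (a $ i)}"
    \<comment> \<open>An edge inside \<open>?A\<close> would have \<open>a\<close>-sum below
      \<open>- 2 * t\<close>, hence negative because \<open>t\<close> is nonnegative.\<close>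
    have "independent_set E ?A"
      using that edges by (fastforce simp: independent_set_def)
    then have "(\<Sum>i\<in>?A. x $ i) \<le> (\<Sum>i\<in>neighbors E ?A. x $ i)"
      by (rule indep)
    \<comment> \<open>If \<open>u\<close> is in \<open>?A\<close> and \<open>{u, v}\<close> is an
      edge, then \<open>a $ v \<ge> - (a $ u) > t\<close>. Enlarging the index set costs nothing as
      \<open>x\<close> is nonnegative.\<close>
    also have "\<dots> \<le> (\<Sum>i\<in>{i. t < a $ i}. x $ i)"
      using edges nonneg by (intro sum_mono2) (fastforce simp: neighbors_def)+
    finally show ?thesis
      by (simp add: left_diff_distrib sum_subtractf of_bool_def if_distrib[of "\<lambda>c. c * _"] sum.If_cases cong: if_cong)
  qed
  ultimately have "0 \<le> (\<Sum>i\<in>UNIV. a $ i * x $ i)"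
    by (rule has_integral_nonneg)
  then show ?thesis
    by (simp add: inner_vec_def)
qed

lemma finite_edge_vectors [simp]: "finite (edge_vectors E)"
proof -
  have "edge_vectors E \<subseteq> (\<lambda>(i, j). axis i 1 + axis j 1) ` UNIV"
    by (auto simp: edge_vectors_def)
  then show ?thesis
    by (rule finite_subset) simp
qed

text \<open>The hull form supplies minimality for one inclusion of the theorem, and closedness of a
  finitely generated cone for separation in the other.\<close>

lemma edge_cone_eq_convex_cone_hull: "edge_cone E = convex_cone hull (edge_vectors E)"
proof
  \<comment> \<open>Stated for arbitrary finite subsets \<open>S\<close> so that induction can add
    one generator at a time.\<close>
  have "(\<Sum>\<alpha>\<in>S. c \<alpha> *\<^sub>R \<alpha>) \<in> convex_cone hull (edge_vectors E)"
    if "finite S" "S \<subseteq> edge_vectors E" "\<forall>\<alpha>\<in>S. 0 \<le> c \<alpha>" for S c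
    using that
    by (induction S rule: finite_induct)
      (auto intro: convex_cone_hull_contains_0 convex_cone_hull_add convex_cone_hull_mul hull_inc)
  then show "edge_cone E \<subseteq> convex_cone hull (edge_vectors E)"
    by (auto simp: edge_cone_def)
next
  have "0 \<in> edge_cone E"
    unfolding edge_cone_def by (auto intro!: exI[of _ "\<lambda>_. 0"])
  moreover have "x + y \<in> edge_cone E" if x: "x \<in> edge_cone E" and y: "y \<in> edge_cone E" for x y
  proof -
    obtain c d where "x = (\<Sum>\<alpha>\<in>edge_vectors E. c \<alpha> *\<^sub>R \<alpha>)" "\<forall>\<alpha>\<in>edge_vectors E. 0 \<le> c \<alpha>"
      "y = (\<Sum>\<alpha>\<in>edge_vectors E. d \<alpha> *\<^sub>R \<alpha>)" "\<forall>\<alpha>\<in>edge_vectors E. 0 \<le> d \<alpha>"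
      using x y unfolding edge_cone_def by blast
    then show ?thesis
      unfolding edge_cone_def
      by (auto intro!: exI[of _ "\<lambda>\<alpha>. c \<alpha> + d \<alpha>"] simp: scaleR_add_left sum.distrib)
  qed
  moreover have "r *\<^sub>R x \<in> edge_cone E" if x: "x \<in> edge_cone E" and r: "0 \<le> r" for x r
  proof -
    obtain c where "x = (\<Sum>\<alpha>\<in>edge_vectors E. c \<alpha> *\<^sub>R \<alpha>)" "\<forall>\<alpha>\<in>edge_vectors E. 0 \<le> c \<alpha>"
      using x unfolding edge_cone_def by blast
    then show ?thesis
      using r unfolding edge_cone_def
      by (auto intro!: exI[of _ "\<lambda>\<alpha>. r * c \<alpha>"] simp: scaleR_sum_right)
  qed
  ultimately have "convex_cone (edge_cone E)"
    by (simp add: convex_cone_iff)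
  moreover have "edge_vectors E \<subseteq> edge_cone E"
  proof
    fix \<alpha> assume \<alpha>: "\<alpha> \<in> edge_vectors E"
    have "(\<Sum>\<beta>\<in>edge_vectors E. of_bool (\<beta> = \<alpha>) *\<^sub>R \<beta>) = \<alpha>"
      using \<alpha> by (simp add: of_bool_def if_distrib[of "\<lambda>c. c *\<^sub>R _"] cong: if_cong)
    then show "\<alpha> \<in> edge_cone E"
      unfolding edge_cone_def by (auto intro!: exI[of _ "\<lambda>\<beta>. of_bool (\<beta> = \<alpha>)"])
  qed
  ultimately show "convex_cone hull (edge_vectors E) \<subseteq> edge_cone E"
    by (intro hull_minimal)
qed

lemma convex_cone_H_minus: "convex_cone (H_minus E A)"
  by (auto simp: convex_cone_iff H_minus_def sum.distrib mult_left_mono intro: add_mono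
      simp flip: sum_distrib_left)

lemma convex_cone_H_unit_plus: "convex_cone (H_unit_plus i)"
  by (auto simp: convex_cone_iff H_unit_plus_def)

lemma edge_vectors_subset_H_unit_plus: "edge_vectors E \<subseteq> H_unit_plus i"
  by (auto simp: edge_vectors_def H_unit_plus_def axis_def)

text \<open>An edge has at most one endpoint in the independent set \<open>A\<close>; if it has one,
  the other endpoint lies in \<open>neighbors E A\<close> and balances it.\<close>

lemma edge_vectors_subset_H_minus:
  assumes "independent_set E A"
  shows "edge_vectors E \<subseteq> H_minus E A"
proof
  fix \<alpha> assume "\<alpha> \<in> edge_vectors E"
  then obtain i j where \<alpha>: "\<alpha> = axis i 1 + axis j 1" and ij: "{i, j} \<in> E"
    by (auto simp: edge_vectors_def)
  have weight: "(\<Sum>k\<in>B. \<alpha> $ k) = of_bool (i \<in> B) + of_bool (j \<in> B)" for B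
    by (simp add: \<alpha> sum.distrib axis_def of_bool_def)
  have ji: "{j, i} \<in> E"
    using ij by (simp add: insert_commute)
  have "i \<in> A \<Longrightarrow> j \<in> neighbors E A" "j \<in> A \<Longrightarrow> i \<in> neighbors E A" "\<not> (i \<in> A \<and> j \<in> A)"
    using assms ij ji by (auto simp: neighbors_def independent_set_def)
  then show "\<alpha> \<in> H_minus E A"
    by (auto simp: H_minus_def weight)
qed

theorem theorem3p6:
  fixes E :: "'n::finite set set"
  assumes "simple_graph E" and "connected_graph E"
  shows "edge_cone E = (\<Inter>A\<in>{A. independent_set E A}. H_minus E A) \<inter> (\<Inter>i. H_unit_plus i)"
proof
  show "edge_cone E \<subseteq> (\<Inter>A\<in>{A. independent_set E A}. H_minus E A) \<inter> (\<Inter>i. H_unit_plus i)"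
    unfolding edge_cone_eq_convex_cone_hull
    \<comment> \<open>Each half-space is a convex cone, so only the generators need
      checking.\<close>
    by (intro Int_greatest INT_greatest hull_minimal convex_cone_H_minus convex_cone_H_unit_plus
        edge_vectors_subset_H_minus edge_vectors_subset_H_unit_plus) simp
next
  show "(\<Inter>A\<in>{A. independent_set E A}. H_minus E A) \<inter> (\<Inter>i. H_unit_plus i) \<subseteq> edge_cone E"
  proof
    fix x assume "x \<in> (\<Inter>A\<in>{A. independent_set E A}. H_minus E A) \<inter> (\<Inter>i. H_unit_plus i)"
    then have nonneg: "\<And>i. 0 \<le> x $ i"
      and indep: "\<And>A. independent_set E A \<Longrightarrow> (\<Sum>i\<in>A. x $ i) \<le> (\<Sum>i\<in>neighbors E A. x $ i)"
      by (auto simp: H_minus_def H_unit_plus_def)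
    let ?C = "convex_cone hull (edge_vectors E)"
    show "x \<in> edge_cone E"
    proof (rule ccontr)
      assume "x \<notin> edge_cone E"
      \<comment> \<open>Strict separation of \<open>x\<close> from the closed cone
        \<open>?C\<close>; since \<open>?C\<close> contains 0, the level \<open>b\<close> is
        negative.\<close>
      then obtain a b where ax: "a \<bullet> x < b" and aC: "\<And>y. y \<in> ?C \<Longrightarrow> b < a \<bullet> y"
        using separating_hyperplane_closed_point[of ?C x] convex_convex_cone_hull
          closed_convex_cone_hull[OF finite_edge_vectors] edge_cone_eq_convex_cone_hull by metis
      have "b < 0"
        using aC[OF convex_cone_hull_contains_0] by simp
      have "0 \<le> a $ i + a $ j" if "{i, j} \<in> E" for i j
      proof (rule ccontr)
        assume neg: "\<not> 0 \<le> a $ i + a $ j"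
        \<comment> \<open>This factor, a quotient of two negative numbers, scales the edge vector to
          a point of \<open>?C\<close> where \<open>a\<close> takes exactly the value
          \<open>b\<close>, against the strict bound \<open>aC\<close>.\<close>
        let ?r = "b / (a $ i + a $ j)"
        have "axis i 1 + axis j 1 \<in> ?C"
          using that by (intro hull_inc) (auto simp: edge_vectors_def)
        then have "?r *\<^sub>R (axis i 1 + axis j 1) \<in> ?C"
          using neg \<open>b < 0\<close> by (intro convex_cone_hull_mul) (auto simp: divide_nonpos_nonpos)
        from aC[OF this] show False
          using neg by (simp add: inner_add_right inner_axis flip: distrib_left)
      qed
      then have "0 \<le> a \<bullet> x"
        using nonneg indep by (rule inner_nonneg_if_nonneg_on_edges)
      with ax \<open>b < 0\<close> show False
        by simp
    qed
  qed
qed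

end
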